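(* For $\mu>0$ let $p_1(x)=\mu^{-1}e^{-x/\mu}$, $x\ge0$, be the exponential density with mean $\mu$. Then: 1) $$\mathcal H^{(1)}(\mu):=\int_0^\infty p_1(x)|\log p_1(x)|\,dx=\begin{cases}2\mu-\log\mu-1,&\mu\le1,\\1+\log\mu,&\mu>1,\end{cases}$$ and it decreases from $+\infty$ to $\log2$ when $\mu$ increases from $0$ to $1/2$, and increases from $\log2$ to $+\infty$ when $\mu$ increases from $1/2$ to $+\infty$. 2) $$\mathcal H^{(2)}(\mu):=\int_0^\infty p_1(x)(-\log p_1(x))_+\,dx=\begin{cases}\mu,&\mu\le1,\\1+\log\mu,&\mu>1,\end{cases}$$ and it increases from $0$ to $+\infty$ when $\mu$ increases from $0$ to $+\infty$. 3) $$\mathcal H^{(3)}(\mu):=\int_0^\infty p_1(x)\log\left((p_1(x))^{-1}+1\right)dx=\log(\mu+1)+\mu\log\left(\frac1\mu+1\right),$$ and it increases from $0$ to $+\infty$ when $\mu$ increases from $0$ to $+\infty$. 4) With $M=\sup_{x\ge0}p_1(x)$, $$\mathcal H^{(4)}(\mu):=\int_0^\infty\frac{p_1(x)}{M}\log\frac{M}{p_1(x)}\,dx=\int_0^\infty e^{-x/\mu}\log e^{x/\mu}\,dx=\mu,$$ and it increases from $0$ to $+\infty$ when $\mu$ increases from $0$ to $+\infty$.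
   Context: $\log$ is the natural logarithm and $a_+=\max(a,0)$. Phrases such as "increases from $0$ to $+\infty$ when $\mu$ increases from $0$ to $+\infty$" mean monotonicity on the indicated interval, with the stated values being attained at, or being the limits at, the endpoints. The functionals $\mathcal H^{(i)}$ are the alternative Shannon entropies $\mathcal H_{SH}^{(i)}$ evaluated at $p_1$. *)

theory Defs
  imports "HOL-Probability.Probability"
begin

(* The library parametrises the exponential density by its rate, i.e. the inverse of its mean. *)
definition p1 :: "real \<Rightarrow> real \<Rightarrow> real" where
  "p1 \<mu> = exponential_density (1 / \<mu>)"

lemma p1_eq: "0 \<le> x \<Longrightarrow> p1 \<mu> x = inverse \<mu> * exp (- x / \<mu>)"
  by (simp add: p1_def exponential_density_def inverse_eq_divide)

(* Integrands of the four alternative Shannon entropies of a density f on the half-line x >= 0.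
   They are named so that their integrability can be stated separately: the Bochner integral
   of a non-integrable function is 0 by convention. *)
definition SH1_integrand :: "(real \<Rightarrow> real) \<Rightarrow> real \<Rightarrow> real" where
  "SH1_integrand f x = f x * \<bar>ln (f x)\<bar>"

definition SH2_integrand :: "(real \<Rightarrow> real) \<Rightarrow> real \<Rightarrow> real" where
  "SH2_integrand f x = f x * max (- ln (f x)) 0"

definition SH3_integrand :: "(real \<Rightarrow> real) \<Rightarrow> real \<Rightarrow> real" where
  "SH3_integrand f x = f x * ln (inverse (f x) + 1)"

definition SH4_integrand :: "(real \<Rightarrow> real) \<Rightarrow> real \<Rightarrow> real" where
  "SH4_integrand f x = (let M = (SUP y\<in>{0..}. f y) in f x / M * ln (M / f x))"

definition H1 :: "real \<Rightarrow> real" where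
  "H1 \<mu> = (LINT x:{0..}|lborel. SH1_integrand (p1 \<mu>) x)"

definition H2 :: "real \<Rightarrow> real" where
  "H2 \<mu> = (LINT x:{0..}|lborel. SH2_integrand (p1 \<mu>) x)"

definition H3 :: "real \<Rightarrow> real" where
  "H3 \<mu> = (LINT x:{0..}|lborel. SH3_integrand (p1 \<mu>) x)"

definition H4 :: "real \<Rightarrow> real" where
  "H4 \<mu> = (LINT x:{0..}|lborel. SH4_integrand (p1 \<mu>) x)"

end

theory Submission
  imports Defs "HOL-Real_Asymp.Real_Asymp"
begin

text \<open>
  On \<open>x \<ge> 0\<close> the negative log-density is the affine function \<open>ln \<mu> + x / \<mu>\<close>
  (\<open>neg_ln_p1\<close>), so three of the four entropies are moments of the exponential law on
  half-lines, all of which have elementary antiderivatives.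

  The ordinary Shannon entropy is \<open>1 + ln \<mu>\<close> (\<open>shannon_entropy_p1\<close>). For \<open>\<mu> \<ge> 1\<close> the
  negative log-density is nonnegative and \<open>H2\<close> is just this entropy. For \<open>\<mu> \<le> 1\<close> it
  changes sign at \<open>a = - \<mu> * ln \<mu>\<close> and equals \<open>(x - a) / \<mu>\<close>; by absence of memory its
  positive part then integrates to the tail probability \<open>exp (- a / \<mu>) = \<mu>\<close>
  (\<open>exponential_tail_moment\<close>). The identity \<open>\<bar>t\<bar> = 2 * max t 0 - t\<close> gives
  \<open>H1 \<mu> = 2 * H2 \<mu> - (1 + ln \<mu>)\<close>, and \<open>H4 \<mu>\<close> is the mean because the supremum of the
  density is its value \<open>1 / \<mu>\<close> at the origin. Only \<open>H3\<close> is not a moment: the substitution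
  \<open>u = exp (- x / \<mu>)\<close> turns it into the integral of \<open>ln (\<mu> + u) - ln u\<close> over the unit
  interval.

  With the closed forms in hand, monotonicity is calculus: on \<open>\<mu> \<le> 1\<close> the derivative of
  \<open>H1\<close> is \<open>2 - 1 / \<mu>\<close>, which changes sign at \<open>1/2\<close>, and the derivative of \<open>H3\<close> is
  \<open>ln (1 / \<mu> + 1) > 0\<close>. The pieces of \<open>H1\<close> and \<open>H2\<close> are glued at \<open>\<mu> = 1\<close>, where the two
  formulas agree.
\<close>

section \<open>Integrals against the exponential density\<close>

text \<open>For a nonnegative integrand, convergence of an antiderivative at infinity already bounds
  the integral of the absolute value, so integrability needs no separate estimate.\<close>

lemma nonneg_half_line_integral:
  fixes f F :: "real \<Rightarrow> real"
  assumes meas: "f \<in> borel_measurable borel"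
    and nonneg: "\<And>x. a \<le> x \<Longrightarrow> 0 \<le> f x"
    and deriv: "\<And>x. a \<le> x \<Longrightarrow> (F has_real_derivative f x) (at x)"
    and lim: "(F \<longlongrightarrow> T) at_top"
  shows "set_integrable lborel {a..} f"
    and "(LINT x:{a..}|lborel. f x) = T - F a"
proof -
  have "F a \<le> T"
  proof (rule tendsto_lowerbound[OF lim])
    show "\<forall>\<^sub>F x in at_top. F a \<le> F x"
      using eventually_ge_at_top[of a]
    proof eventually_elim
      case (elim x)
      show ?case
        by (rule DERIV_nonneg_imp_nondecreasing[OF elim]) (use deriv nonneg in blast)
    qed
  qed simp
  moreover have "(\<integral>\<^sup>+x. ennreal (indicator {a..} x *\<^sub>R f x) \<partial>lborel) = ennreal (T - F a)"
  proof -
    have "(\<integral>\<^sup>+x. ennreal (indicator {a..} x *\<^sub>R f x) \<partial>lborel) =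
        (\<integral>\<^sup>+x. ennreal (f x) * indicator {a..} x \<partial>lborel)"
      by (intro nn_integral_cong) (simp split: split_indicator)
    also have "\<dots> = ennreal (T - F a)"
      by (rule nn_integral_FTC_atLeast[OF meas deriv nonneg lim])
    finally show ?thesis .
  qed
  moreover have "AE x in lborel. 0 \<le> indicator {a..} x *\<^sub>R f x"
    using nonneg by (simp add: indicator_def)
  ultimately have "has_bochner_integral lborel (\<lambda>x. indicator {a..} x *\<^sub>R f x) (T - F a)"
    using meas by (intro has_bochner_integral_nn_integral) auto
  then show "set_integrable lborel {a..} f" "(LINT x:{a..}|lborel. f x) = T - F a"
    unfolding set_integrable_def set_lebesgue_integral_def
    by (simp_all add: has_bochner_integral_iff)
qed

lemma exponential_tail:
  fixes a \<mu> :: real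
  assumes "0 < \<mu>"
  shows "set_integrable lborel {a..} (\<lambda>x. inverse \<mu> * exp (- x / \<mu>))"
    and "(LINT x:{a..}|lborel. inverse \<mu> * exp (- x / \<mu>)) = exp (- a / \<mu>)"
proof -
  let ?f = "\<lambda>x. inverse \<mu> * exp (- x / \<mu>)"
  let ?F = "\<lambda>x. - exp (- x / \<mu>)"
  have d: "(?F has_real_derivative ?f x) (at x)" for x
    using assms by (auto intro!: derivative_eq_intros simp: field_simps)
  have l: "(?F \<longlongrightarrow> 0) at_top"
    using assms by real_asymp
  show "set_integrable lborel {a..} ?f"
    by (rule nonneg_half_line_integral(1)[OF _ _ d l]) (use assms in auto)
  have "(LINT x:{a..}|lborel. ?f x) = 0 - ?F a"
    by (rule nonneg_half_line_integral(2)[OF _ _ d l]) (use assms in auto)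
  then show "(LINT x:{a..}|lborel. ?f x) = exp (- a / \<mu>)" by simp
qed

text \<open>Conditioned on exceeding \<open>a\<close>, an exponential variable exceeds it by \<open>\<mu>\<close> on average; thus
  the mean excess in units of \<open>\<mu>\<close> has the same integral as the tail itself. The lower end \<open>a\<close>
  is where the integrand vanishes, so that it is nonnegative on the whole half-line.\<close>

lemma exponential_tail_moment:
  fixes a \<mu> :: real
  assumes "0 < \<mu>"
  shows "set_integrable lborel {a..} (\<lambda>x. inverse \<mu> * exp (- x / \<mu>) * ((x - a) / \<mu>))"
    and "(LINT x:{a..}|lborel. inverse \<mu> * exp (- x / \<mu>) * ((x - a) / \<mu>)) = exp (- a / \<mu>)"
proof -
  let ?f = "\<lambda>x. inverse \<mu> * exp (- x / \<mu>) * ((x - a) / \<mu>)"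
  let ?F = "\<lambda>x. - exp (- x / \<mu>) * ((x - a) / \<mu> + 1)"
  have d: "(?F has_real_derivative ?f x) (at x)" for x
    using assms by (auto intro!: derivative_eq_intros simp: field_simps)
  have l: "(?F \<longlongrightarrow> 0) at_top"
    using assms by real_asymp
  show "set_integrable lborel {a..} ?f"
    by (rule nonneg_half_line_integral(1)[OF _ _ d l]) (use assms in auto)
  have "(LINT x:{a..}|lborel. ?f x) = 0 - ?F a"
    by (rule nonneg_half_line_integral(2)[OF _ _ d l]) (use assms in auto)
  then show "(LINT x:{a..}|lborel. ?f x) = exp (- a / \<mu>)" by simp
qed

section \<open>Closed forms of the four entropies\<close>

lemma neg_ln_p1:
  assumes "0 < \<mu>" "0 \<le> x"
  shows "- ln (p1 \<mu> x) = ln \<mu> + x / \<mu>"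
  using assms by (simp add: p1_eq ln_mult ln_inverse)

text \<open>For \<open>\<mu> < 1\<close> the integrand takes both signs. It is therefore split into multiples of the
  total mass and the first moment, whose integrands are nonnegative.\<close>

lemma shannon_entropy_p1:
  assumes "0 < \<mu>"
  shows "set_integrable lborel {0..} (\<lambda>x. p1 \<mu> x * - ln (p1 \<mu> x))"
    and "(LINT x:{0..}|lborel. p1 \<mu> x * - ln (p1 \<mu> x)) = 1 + ln \<mu>"
proof -
  let ?p = "\<lambda>x. inverse \<mu> * exp (- x / \<mu>)"
  let ?q = "\<lambda>x. ?p x * ((x - 0) / \<mu>)"
  have eq: "p1 \<mu> x * - ln (p1 \<mu> x) = ln \<mu> * ?p x + ?q x" if "x \<in> {0..}" for x
    using that assms by (subst neg_ln_p1) (auto simp: p1_eq algebra_simps)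
  note tail = exponential_tail[OF assms, of 0] exponential_tail_moment[OF assms, of 0]
  have i: "set_integrable lborel {0..} (\<lambda>x. ln \<mu> * ?p x)"
    using tail(1) by (rule set_integrable_mult_right)
  have "set_integrable lborel {0..} (\<lambda>x. p1 \<mu> x * - ln (p1 \<mu> x)) \<longleftrightarrow>
      set_integrable lborel {0..} (\<lambda>x. ln \<mu> * ?p x + ?q x)"
    by (rule set_integrable_cong[OF refl refl eq])
  then show "set_integrable lborel {0..} (\<lambda>x. p1 \<mu> x * - ln (p1 \<mu> x))"
    using set_integral_add(1)[OF i tail(3)] by simp
  have "(LINT x:{0..}|lborel. p1 \<mu> x * - ln (p1 \<mu> x)) =
      (LINT x:{0..}|lborel. ln \<mu> * ?p x + ?q x)"
    by (rule set_lebesgue_integral_cong) (use eq in auto)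
  also have "\<dots> = ln \<mu> * (LINT x:{0..}|lborel. ?p x) + (LINT x:{0..}|lborel. ?q x)"
    by (subst set_integral_add(2)[OF i tail(3)]) (simp only: set_integral_mult_right)
  also have "\<dots> = 1 + ln \<mu>"
    by (subst tail(2), subst tail(4)) simp
  finally show "(LINT x:{0..}|lborel. p1 \<mu> x * - ln (p1 \<mu> x)) = 1 + ln \<mu>" .
qed

lemma H2_closed_form:
  assumes "0 < \<mu>"
  shows "set_integrable lborel {0..} (SH2_integrand (p1 \<mu>))"
    and "H2 \<mu> = (if \<mu> \<le> 1 then \<mu> else 1 + ln \<mu>)"
proof -
  have "set_integrable lborel {0..} (SH2_integrand (p1 \<mu>)) \<and>
      H2 \<mu> = (if \<mu> \<le> 1 then \<mu> else 1 + ln \<mu>)"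
  proof (cases "\<mu> \<le> 1")
    case True
    \<comment> \<open>The density exceeds 1 exactly to the left of \<open>a\<close>, so only the half-line from \<open>a\<close> on
      contributes.\<close>
    define a where "a = - \<mu> * ln \<mu>"
    let ?q = "\<lambda>x. inverse \<mu> * exp (- x / \<mu>) * ((x - a) / \<mu>)"
    have a: "0 \<le> a" and exp_a: "exp (- a / \<mu>) = \<mu>"
      using True assms by (auto simp: a_def mult_le_0_iff)
    have neg_ln: "- ln (p1 \<mu> x) = (x - a) / \<mu>" if "0 \<le> x" for x
      using assms by (subst neg_ln_p1[OF assms that]) (simp add: a_def field_simps)
    have eq: "indicator {0..} x *\<^sub>R SH2_integrand (p1 \<mu>) x = indicator {a..} x *\<^sub>R ?q x" for x
    proof (cases "0 \<le> x")
      case True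
      then show ?thesis
        unfolding SH2_integrand_def neg_ln[OF True]
        using assms by (auto simp: p1_eq indicator_def max_def divide_le_0_iff zero_le_divide_iff)
    next
      case False
      then show ?thesis using a by (simp add: indicator_def)
    qed
    show ?thesis
      using exponential_tail_moment[OF assms, of a] True
      unfolding H2_def set_integrable_def set_lebesgue_integral_def eq exp_a by simp
  next
    case False
    have eq: "SH2_integrand (p1 \<mu>) x = p1 \<mu> x * - ln (p1 \<mu> x)" if "x \<in> {0..}" for x
    proof -
      have "0 \<le> - ln (p1 \<mu> x)"
        using that False by (subst neg_ln_p1) auto
      then show ?thesis by (simp add: SH2_integrand_def)
    qed
    have "set_integrable lborel {0..} (SH2_integrand (p1 \<mu>))"
      by (rule iffD2[OF set_integrable_cong[OF refl refl eq] shannon_entropy_p1(1)[OF assms]])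
    moreover have "H2 \<mu> = (LINT x:{0..}|lborel. p1 \<mu> x * - ln (p1 \<mu> x))"
      unfolding H2_def by (rule set_lebesgue_integral_cong) (use eq in auto)
    ultimately show ?thesis
      using shannon_entropy_p1(2)[OF assms] False by simp
  qed
  then show "set_integrable lborel {0..} (SH2_integrand (p1 \<mu>))"
    and "H2 \<mu> = (if \<mu> \<le> 1 then \<mu> else 1 + ln \<mu>)" by auto
qed

text \<open>Since \<open>\<bar>t\<bar> = 2 * max t 0 - t\<close>, this integral is a combination of \<open>H2\<close> and the ordinary
  entropy.\<close>

lemma H1_closed_form:
  assumes "0 < \<mu>"
  shows "set_integrable lborel {0..} (SH1_integrand (p1 \<mu>))"
    and "H1 \<mu> = (if \<mu> \<le> 1 then 2 * \<mu> - ln \<mu> - 1 else 1 + ln \<mu>)"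
proof -
  let ?s = "\<lambda>x. p1 \<mu> x * - ln (p1 \<mu> x)"
  have eq: "SH1_integrand (p1 \<mu>) = (\<lambda>x. 2 * SH2_integrand (p1 \<mu>) x - ?s x)"
    by (auto simp: fun_eq_iff SH1_integrand_def SH2_integrand_def abs_if max_def)
  have i: "set_integrable lborel {0..} (\<lambda>x. 2 * SH2_integrand (p1 \<mu>) x)"
    using H2_closed_form(1)[OF assms] by (rule set_integrable_mult_right)
  note diff = set_integral_diff[OF i shannon_entropy_p1(1)[OF assms]]
  show "set_integrable lborel {0..} (SH1_integrand (p1 \<mu>))"
    unfolding eq by (rule diff(1))
  have "H1 \<mu> = 2 * H2 \<mu> - (1 + ln \<mu>)"
    unfolding H1_def eq diff(2) shannon_entropy_p1(2)[OF assms] H2_def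
    by (simp only: set_integral_mult_right)
  then show "H1 \<mu> = (if \<mu> \<le> 1 then 2 * \<mu> - ln \<mu> - 1 else 1 + ln \<mu>)"
    by (simp add: H2_closed_form(2)[OF assms])
qed

text \<open>With \<open>u = exp (- x / \<mu>)\<close> the measure with density \<open>p1 \<mu>\<close> becomes the uniform one on the
  unit interval and the logarithm becomes \<open>ln (\<mu> + u) - ln u\<close>. An antiderivative in \<open>u\<close> is
  \<open>(\<mu> + u) * ln (\<mu> + u) - u * ln u\<close>, and \<open>ln u = - x / \<mu>\<close>.\<close>

lemma H3_closed_form:
  assumes "0 < \<mu>"
  shows "set_integrable lborel {0..} (SH3_integrand (p1 \<mu>))"
    and "H3 \<mu> = ln (\<mu> + 1) + \<mu> * ln (1 / \<mu> + 1)"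
proof -
  let ?f = "\<lambda>x. inverse \<mu> * exp (- x / \<mu>) * ln (\<mu> * exp (x / \<mu>) + 1)"
  \<comment> \<open>The antiderivative in \<open>u\<close> with its sign reversed, because \<open>u\<close> decreases as \<open>x\<close> grows.\<close>
  define F where "F x = - ((\<mu> + exp (- x / \<mu>)) * ln (\<mu> + exp (- x / \<mu>)))
      - exp (- x / \<mu>) * (x / \<mu>)" for x
  have eq: "SH3_integrand (p1 \<mu>) x = ?f x" if "x \<in> {0..}" for x
    using that by (simp add: SH3_integrand_def p1_eq exp_minus)
  have d: "(F has_real_derivative ?f x) (at x)" for x
  proof -
    define u where "u = exp (- x / \<mu>)"
    have u: "0 < u" "\<mu> + u > 0" using assms by (auto simp: u_def add_pos_pos)
    have "\<mu> * exp (x / \<mu>) + 1 = (\<mu> + u) / u"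
      by (simp add: u_def exp_minus field_simps)
    moreover have "ln u = - x / \<mu>" by (simp add: u_def)
    ultimately have "ln (\<mu> * exp (x / \<mu>) + 1) = ln (\<mu> + u) + x / \<mu>"
      using u by (simp add: ln_div)
    then have val: "?f x = inverse \<mu> * u * (ln (\<mu> + u) + x / \<mu>)"
      by (simp add: u_def)
    \<comment> \<open>Naming the two transcendental factors leaves a derivative made of sums and products
      only.\<close>
    define U where "U x = exp (- x / \<mu>)" for x
    define L where "L x = ln (\<mu> + U x)" for x
    have dU: "(U has_real_derivative - inverse \<mu> * u) (at x)"
      unfolding U_def[abs_def] using assms
      by (auto intro!: derivative_eq_intros simp: u_def field_simps)
    have dL: "(L has_real_derivative - inverse \<mu> * u / (\<mu> + u)) (at x)"
      unfolding L_def[abs_def] using u assms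
      by (auto intro!: derivative_eq_intros dU simp: U_def u_def inverse_eq_divide)
    have "((\<lambda>x. - ((\<mu> + U x) * L x) - U x * (x / \<mu>)) has_real_derivative
        - ((0 + - inverse \<mu> * u) * L x + (- inverse \<mu> * u / (\<mu> + u)) * (\<mu> + U x))
        - (- inverse \<mu> * u * (x / \<mu>) + 1 / \<mu> * U x)) (at x)"
      by (rule DERIV_diff DERIV_minus DERIV_mult DERIV_add DERIV_const DERIV_cdivide DERIV_ident dU dL)+
    moreover have "U x = u" "L x = ln (\<mu> + u)"
      by (simp_all add: U_def L_def u_def)
    moreover have "F = (\<lambda>x. - ((\<mu> + U x) * L x) - U x * (x / \<mu>))"
      by (simp add: fun_eq_iff F_def U_def L_def)
    moreover have "- inverse \<mu> * u / (\<mu> + u) * (\<mu> + u) = - inverse \<mu> * u"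
      using u by simp
    ultimately have "(F has_real_derivative
        - (- inverse \<mu> * u * ln (\<mu> + u) + - inverse \<mu> * u)
        - (- inverse \<mu> * u * (x / \<mu>) + 1 / \<mu> * u)) (at x)"
      by simp
    then show ?thesis
      unfolding val by (rule DERIV_cong) (simp add: divide_inverse algebra_simps)
  qed
  have l: "(F \<longlongrightarrow> - \<mu> * ln \<mu>) at_top"
    unfolding F_def using assms by real_asymp
  have nonneg: "0 \<le> ?f x" for x
    using assms by (intro mult_nonneg_nonneg ln_ge_zero) auto
  have int: "set_integrable lborel {0..} ?f"
    by (rule nonneg_half_line_integral(1)[OF _ nonneg d l]) measurable
  show "set_integrable lborel {0..} (SH3_integrand (p1 \<mu>))"
    by (rule iffD2[OF set_integrable_cong[OF refl refl eq] int])
  have "H3 \<mu> = (LINT x:{0..}|lborel. ?f x)"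
    unfolding H3_def by (rule set_lebesgue_integral_cong) (use eq in auto)
  also have "\<dots> = - \<mu> * ln \<mu> - F 0"
    by (rule nonneg_half_line_integral(2)[OF _ nonneg d l]) measurable
  also have "\<dots> = ln (\<mu> + 1) + \<mu> * (ln (\<mu> + 1) - ln \<mu>)"
    by (simp add: F_def algebra_simps)
  also have "ln (\<mu> + 1) - ln \<mu> = ln (1 / \<mu> + 1)"
    using assms ln_div[of "\<mu> + 1" \<mu>] by (simp add: add_divide_distrib add.commute)
  finally show "H3 \<mu> = ln (\<mu> + 1) + \<mu> * ln (1 / \<mu> + 1)" .
qed

lemma p1_le:
  assumes "0 < \<mu>" "0 \<le> x"
  shows "p1 \<mu> x \<le> inverse \<mu>"
  using assms by (simp add: p1_eq)

lemma bdd_above_p1: "0 < \<mu> \<Longrightarrow> bdd_above (p1 \<mu> ` {0..})"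
  by (rule bdd_aboveI[of _ "inverse \<mu>"]) (auto simp: p1_le)

lemma SUP_p1:
  assumes "0 < \<mu>"
  shows "(SUP y\<in>{0..}. p1 \<mu> y) = inverse \<mu>"
proof (rule cSup_eq_maximum)
  show "inverse \<mu> \<in> p1 \<mu> ` {0..}"
    by (rule image_eqI[of _ _ 0]) (simp_all add: p1_eq)
qed (use assms p1_le in auto)

lemma H4_closed_form:
  assumes "0 < \<mu>"
  shows "set_integrable lborel {0..} (SH4_integrand (p1 \<mu>))"
    and "set_integrable lborel {0..} (\<lambda>x. exp (- x / \<mu>) * ln (exp (x / \<mu>)))"
    and "H4 \<mu> = (LINT x:{0..}|lborel. exp (- x / \<mu>) * ln (exp (x / \<mu>)))"
    and "H4 \<mu> = \<mu>"
proof -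
  let ?g = "\<lambda>x. exp (- x / \<mu>) * ln (exp (x / \<mu>))"
  let ?q = "\<lambda>x. inverse \<mu> * exp (- x / \<mu>) * ((x - 0) / \<mu>)"
  have eq: "SH4_integrand (p1 \<mu>) x = ?g x" if "x \<in> {0..}" for x
  proof -
    have "p1 \<mu> x / inverse \<mu> = exp (- x / \<mu>)"
      using that assms by (simp add: p1_eq)
    moreover from this have "inverse \<mu> / p1 \<mu> x = exp (x / \<mu>)"
      by (metis exp_minus inverse_divide inverse_inverse_eq minus_divide_left)
    ultimately show ?thesis
      by (simp only: SH4_integrand_def Let_def SUP_p1[OF assms])
  qed
  have g: "?g = (\<lambda>x. \<mu> * ?q x)"
    using assms by (simp add: fun_eq_iff divide_inverse)
  note moment = exponential_tail_moment[OF assms, of 0]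
  show int: "set_integrable lborel {0..} ?g"
    unfolding g using moment(1) by (rule set_integrable_mult_right)
  show "set_integrable lborel {0..} (SH4_integrand (p1 \<mu>))"
    by (rule iffD2[OF set_integrable_cong[OF refl refl eq] int])
  show H4: "H4 \<mu> = (LINT x:{0..}|lborel. ?g x)"
    unfolding H4_def by (rule set_lebesgue_integral_cong) (use eq in auto)
  show "H4 \<mu> = \<mu>"
    unfolding H4 g set_integral_mult_right moment(2) by simp
qed

section \<open>Monotonicity and limits\<close>

text \<open>Strict concavity: the logarithm lies below its tangent at \<open>a\<close>. Comparing the slope \<open>1 / a\<close>
  with 2 decides the monotonicity of \<open>2 * \<mu> - ln \<mu>\<close> on either side of \<open>1/2\<close>.\<close>

lemma ln_diff_less:
  fixes a b :: real
  assumes "0 < a" "0 < b" "a \<noteq> b"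
  shows "ln b - ln a < (b - a) / a"
proof -
  have "ln (b / a) \<noteq> b / a - 1" "ln (b / a) \<le> b / a - 1"
    using assms ln_eq_minus_one[of "b / a"] ln_le_minus_one[of "b / a"] by auto
  then have "ln (b / a) < b / a - 1" by simp
  then show ?thesis
    using assms by (simp add: ln_div diff_divide_distrib)
qed

lemma H1_strict_antimono: "strict_antimono_on {0<..1/2} H1"
proof (rule monotone_onI)
  fix a b :: real
  assume ab: "a \<in> {0<..1/2}" "b \<in> {0<..1/2}" "a < b"
  have "ln a - ln b < (a - b) / b"
    using ab by (intro ln_diff_less) auto
  also have "\<dots> \<le> 2 * (a - b)"
    using ab divide_left_mono[of b "1/2" "b - a"] by (simp add: diff_divide_distrib)
  finally show "H1 b < H1 a"
    using ab by (simp add: H1_closed_form(2))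
qed

lemma H1_strict_mono: "strict_mono_on {1/2..} H1"
proof (rule strict_mono_onI)
  fix a b :: real
  assume ab: "a \<in> {1/2..}" "b \<in> {1/2..}" "a < b"
  have left: "2 * s - ln s < 2 * t - ln t" if "1/2 \<le> s" "s < t" for s t :: real
  proof -
    have "ln t - ln s < (t - s) / s"
      using that by (intro ln_diff_less) auto
    also have "\<dots> \<le> 2 * (t - s)"
      using that divide_left_mono[of "1/2" s "t - s"] by simp
    finally show ?thesis by simp
  qed
  \<comment> \<open>When the points straddle 1, the common value 1 of both formulas there separates them.\<close>
  consider "b \<le> 1" | "a \<le> 1" "1 < b" | "1 < a" using ab by linarith
  then show "H1 a < H1 b"
  proof cases
    case 1
    then show ?thesis using ab left[of a b] by (simp add: H1_closed_form(2))
  next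
    case 2
    then have "2 * a - ln a \<le> 2" using ab left[of a 1] by (cases "a = 1") auto
    moreover have "0 < ln b" using 2 by simp
    ultimately have "2 * a - ln a - 1 < 1 + ln b" by linarith
    then show ?thesis using ab 2 by (simp add: H1_closed_form(2))
  next
    case 3
    then show ?thesis using ab by (simp add: H1_closed_form(2))
  qed
qed

lemma H2_strict_mono: "strict_mono_on {0<..} H2"
proof (rule strict_mono_onI)
  fix a b :: real
  assume ab: "a \<in> {0<..}" "b \<in> {0<..}" "a < b"
  have "a < 1 + ln b" if "a \<le> 1" "1 < b"
    using that ln_gt_zero[of b] by linarith
  then show "H2 a < H2 b"
    using ab by (auto simp: H2_closed_form(2))
qed

lemma H3_strict_mono: "strict_mono_on {0<..} H3"
proof (rule strict_mono_onI)
  fix a b :: real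
  assume ab: "a \<in> {0<..}" "b \<in> {0<..}" "a < b"
  let ?h = "\<lambda>\<mu>::real. ln (\<mu> + 1) + \<mu> * ln (1 / \<mu> + 1)"
  have "?h a < ?h b"
  proof (rule DERIV_pos_imp_increasing[OF ab(3)])
    fix x assume "a \<le> x" "x \<le> b"
    then have x: "0 < x" "0 < x + 1" "0 < 1 / x + 1" using ab by (auto simp: add_pos_pos)
    have "(?h has_real_derivative
        1 / (x + 1) + (ln (1 / x + 1) + - inverse (x ^ 2) / (1 / x + 1) * x)) (at x)"
      by (rule derivative_eq_intros refl | (use x in linarith))+
        (use x in \<open>simp add: divide_simps power2_eq_square\<close>)
    \<comment> \<open>The derivatives of the rational factors cancel and only the logarithm remains.\<close>
    moreover have "- inverse (x ^ 2) / (1 / x + 1) * x = - (1 / (x + 1))"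
      using x by (simp add: divide_simps power2_eq_square)
    ultimately have "(?h has_real_derivative ln (1 / x + 1)) (at x)" by simp
    moreover have "0 < ln (1 / x + 1)" using x by simp
    ultimately show "\<exists>y. (?h has_real_derivative y) (at x) \<and> 0 < y" by blast
  qed
  then show "H3 a < H3 b" using ab by (simp add: H3_closed_form(2))
qed

theorem proposition2:
  shows
    "((\<forall>\<mu>>0. set_integrable lborel {0..} (SH1_integrand (p1 \<mu>)) \<and>
        H1 \<mu> = (if \<mu> \<le> 1 then 2 * \<mu> - ln \<mu> - 1 else 1 + ln \<mu>)) \<and>
      strict_antimono_on {0<..1/2} H1 \<and>
      filterlim H1 at_top (at_right 0) \<and>
      H1 (1/2) = ln 2 \<and>
      strict_mono_on {1/2..} H1 \<and>
      filterlim H1 at_top at_top)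
   \<and> ((\<forall>\<mu>>0. set_integrable lborel {0..} (SH2_integrand (p1 \<mu>)) \<and>
        H2 \<mu> = (if \<mu> \<le> 1 then \<mu> else 1 + ln \<mu>)) \<and>
      strict_mono_on {0<..} H2 \<and>
      (H2 \<longlongrightarrow> 0) (at_right 0) \<and>
      filterlim H2 at_top at_top)
   \<and> ((\<forall>\<mu>>0. set_integrable lborel {0..} (SH3_integrand (p1 \<mu>)) \<and>
        H3 \<mu> = ln (\<mu> + 1) + \<mu> * ln (1 / \<mu> + 1)) \<and>
      strict_mono_on {0<..} H3 \<and>
      (H3 \<longlongrightarrow> 0) (at_right 0) \<and>
      filterlim H3 at_top at_top)
   \<and> ((\<forall>\<mu>>0. bdd_above (p1 \<mu> ` {0..}) \<and>
        set_integrable lborel {0..} (SH4_integrand (p1 \<mu>)) \<and>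
        set_integrable lborel {0..} (\<lambda>x. exp (- x / \<mu>) * ln (exp (x / \<mu>))) \<and>
        H4 \<mu> = (LINT x:{0..}|lborel. exp (- x / \<mu>) * ln (exp (x / \<mu>))) \<and>
        H4 \<mu> = \<mu>) \<and>
      strict_mono_on {0<..} H4 \<and>
      (H4 \<longlongrightarrow> 0) (at_right 0) \<and>
      filterlim H4 at_top at_top)"
proof -
  have near_0: "\<forall>\<^sub>F \<mu>::real in at_right 0. 0 < \<mu> \<and> \<mu> \<le> 1"
    by (auto simp: eventually_at_right_field intro!: exI[of _ 1])
  have near_inf: "\<forall>\<^sub>F \<mu>::real in at_top. 1 < \<mu>"
    by (rule eventually_gt_at_top)
  have H1_0: "filterlim H1 at_top (at_right 0)"
  proof -
    have "filterlim (\<lambda>\<mu>::real. 2 * \<mu> - ln \<mu> - 1) at_top (at_right 0)" by real_asymp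
    moreover have "\<forall>\<^sub>F \<mu> in at_right 0. 2 * \<mu> - ln \<mu> - 1 = H1 \<mu>"
      using near_0 by eventually_elim (simp add: H1_closed_form(2))
    ultimately show ?thesis by (rule filterlim_cong[OF refl refl, THEN iffD1, rotated])
  qed
  have log_inf: "filterlim (\<lambda>\<mu>::real. 1 + ln \<mu>) at_top at_top" by real_asymp
  have H1_inf: "filterlim H1 at_top at_top"
  proof (rule filterlim_cong[OF refl refl, THEN iffD1, OF _ log_inf])
    show "\<forall>\<^sub>F \<mu> in at_top. 1 + ln \<mu> = H1 \<mu>"
      using near_inf by eventually_elim (simp add: H1_closed_form(2))
  qed
  have H2_0: "(H2 \<longlongrightarrow> 0) (at_right 0)"
  proof (rule tendsto_cong[THEN iffD1])
    show "\<forall>\<^sub>F \<mu> in at_right 0. \<mu> = H2 \<mu>"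
      using near_0 by eventually_elim (simp add: H2_closed_form(2))
  qed real_asymp
  have H2_inf: "filterlim H2 at_top at_top"
  proof (rule filterlim_cong[OF refl refl, THEN iffD1, OF _ log_inf])
    show "\<forall>\<^sub>F \<mu> in at_top. 1 + ln \<mu> = H2 \<mu>"
      using near_inf by eventually_elim (simp add: H2_closed_form(2))
  qed
  let ?h = "\<lambda>\<mu>::real. ln (\<mu> + 1) + \<mu> * ln (1 / \<mu> + 1)"
  have H3_0: "(H3 \<longlongrightarrow> 0) (at_right 0)"
  proof (rule tendsto_cong[THEN iffD1])
    show "\<forall>\<^sub>F \<mu> in at_right 0. ?h \<mu> = H3 \<mu>"
      using near_0 by eventually_elim (simp add: H3_closed_form(2))
  qed real_asymp
  have H3_inf: "filterlim H3 at_top at_top"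
  proof (rule filterlim_cong[OF refl refl, THEN iffD1])
    show "\<forall>\<^sub>F \<mu> in at_top. ?h \<mu> = H3 \<mu>"
      using near_inf by eventually_elim (simp add: H3_closed_form(2))
  qed real_asymp
  have H4_0: "(H4 \<longlongrightarrow> 0) (at_right 0)"
  proof (rule tendsto_cong[THEN iffD1])
    show "\<forall>\<^sub>F \<mu> in at_right 0. \<mu> = H4 \<mu>"
      using near_0 by eventually_elim (simp add: H4_closed_form(4))
  qed real_asymp
  have H4_inf: "filterlim H4 at_top at_top"
  proof (rule filterlim_cong[OF refl refl, THEN iffD1, OF _ filterlim_ident])
    show "\<forall>\<^sub>F \<mu> in at_top. \<mu> = H4 \<mu>"
      using near_inf by eventually_elim (simp add: H4_closed_form(4))
  qed
  have H1_min: "H1 (1/2) = ln 2"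
    by (simp add: H1_closed_form(2) ln_div)
  have H4_mono: "strict_mono_on {0<..} H4"
    by (rule strict_mono_onI) (simp add: H4_closed_form(4))
  show ?thesis
    by (intro conjI allI impI H1_closed_form H2_closed_form H3_closed_form H4_closed_form
        bdd_above_p1 H1_strict_antimono H1_strict_mono H2_strict_mono H3_strict_mono H4_mono
        H1_0 H1_inf H1_min H2_0 H2_inf H3_0 H3_inf H4_0 H4_inf)
qed

end
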